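(* Assume that $u\mapsto \ell(t,s,q,u,w)$ is convex and differentiable for fixed $(t,s,q,w)$, and define the marginal avoided system cost $m(t,s,q,u)=-\partial \ell/\partial u$ and the continuous water value $\lambda_W=-V_s$. If $m$ is nonincreasing in $u$, then the minimizer $u^*$ (in the release variable $u$) of the Hamilton–Jacobi–Bellman (HJB) equation of the context satisfies $$u^*=\begin{cases}0, & m(t,s,q,0)\le \lambda_W,\\ U_{\max}, & m(t,s,q,U_{\max})\ge \lambda_W,\\ u:\ m(t,s,q,u)=\lambda_W, & \text{otherwise,}\end{cases}$$ subject to storage feasibility.
   Context: The storage state follows $dS_t=(Q_t-u_t-w_t)\,dt$ with $0\le S_t\le S_{\max}$, where $u_t\in[0,U_{\max}]$ is the turbine release, $w_t\ge 0$ the spill, and the inflow $Q_t\ge0$ satisfies $dQ_t=\kappa\{\theta(t)-Q_t\}dt+\sigma_0\sqrt{Q_t}\,dW_t$ with $W$ a standard Brownian motion, $\kappa,\sigma_0>0$ and $\theta$ a deterministic positive seasonal target. With running cost $\ell$, terminal cost $g$ and discount rate $\rho$, the value function is $$V(t,s,q)=\inf_{u,w}\mathbb{E}_{t,s,q}\Big[\int_t^T e^{-\rho(\tau-t)}\ell(\tau,S_\tau,Q_\tau,u_\tau,w_\tau)\,d\tau+e^{-\rho(T-t)}g(S_T)\Big],$$ and the HJB equation, understood in the state-constrained viscosity sense, is $$-V_t=\min_{(u,w)\in\mathcal U(s,q)}\Big\{\ell(t,s,q,u,w)+(q-u-w)V_s+\kappa[\theta(t)-q]V_q+\tfrac12\sigma_0^2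 q V_{qq}-\rho V\Big\},\qquad V(T,s,q)=g(s),$$ where $\mathcal U(s,q)$ is the set of admissible $(u,w)$ with $0\le u\le U_{\max}$, $w\ge0$ that respect the storage state constraints (release is limited by water availability near $s=0$, while spill becomes active at the upper storage boundary $s=S_{\max}$). "Subject to storage feasibility" means that, at a fixed state, $u$ ranges over $[0,\bar u]$, where $\bar u=\bar u(t,s,q)$ is the largest release consistent with turbine and state feasibility, and $\bar u$ takes the place of $U_{\max}$ in the formula when it is smaller. With terms independent of $u$ suppressed, the minimization over $u$ is that of $u\mapsto \ell(t,s,q,u,w)-uV_s$ over $0\le u\le\bar u$. *)

theory Defs
  imports "HOL-Probability.Probability"
begin

text \<open>
  Storage is written s, inflow q, turbine release u and spill w. The running cost takes its
  arguments in the order t, s, q, u, w. The field release_cap is the largest release consistent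
  with turbine and state feasibility at the state (t, s, q); only the bounds
  0 <= release_cap <= release_max are imposed on it, so every feasibility convention near the
  storage boundaries is covered.
\<close>

record storage_model =
  horizon :: real
  storage_max :: real
  release_max :: real
  release_cap :: "real \<Rightarrow> real \<Rightarrow> real \<Rightarrow> real"
  reversion_rate :: real
  volatility :: real
  seasonal_target :: "real \<Rightarrow> real"
  discount_rate :: real
  running_cost :: "real \<Rightarrow> real \<Rightarrow> real \<Rightarrow> real \<Rightarrow> real \<Rightarrow> real"
  terminal_cost :: "real \<Rightarrow> real"

definition state_space :: "storage_model \<Rightarrow> (real \<times> real) set" where
  "state_space P = {0..storage_max P} \<times> {0..}"

definition storage_model_wf :: "storage_model \<Rightarrow> bool" where
  "storage_model_wf P \<longleftrightarrow>
     0 < horizon P \<and> 0 < storage_max P \<and> 0 < release_max P \<and>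
     0 < reversion_rate P \<and> 0 < volatility P \<and>
     (\<forall>t\<in>{0..horizon P}. 0 < seasonal_target P t) \<and>
     set_integrable lborel {0..horizon P} (seasonal_target P) \<and>
     (\<forall>t\<in>{0..horizon P}. \<forall>(s, q)\<in>state_space P.
        0 \<le> release_cap P t s q \<and> release_cap P t s q \<le> release_max P)"

subsection \<open>The controlled dynamics and the value function\<close>

text \<open>The null sets are put into F 0 so that strong solutions can be adapted to F.\<close>

definition filtered_space :: "'a measure \<Rightarrow> (real \<Rightarrow> 'a measure) \<Rightarrow> bool" where
  "filtered_space M F \<longleftrightarrow>
     prob_space M \<and> filtration (space M) F \<and> (\<forall>t. subalgebra M (F t)) \<and>
     null_sets M \<subseteq> sets (F 0)"

definition standard_brownian_motion ::
  "'a measure \<Rightarrow> (real \<Rightarrow> 'a measure) \<Rightarrow> (real \<Rightarrow> 'a \<Rightarrow> real) \<Rightarrow> bool" where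
  "standard_brownian_motion M F W \<longleftrightarrow>
     (\<forall>t\<ge>0. W t \<in> borel_measurable (F t)) \<and>
     (AE \<omega> in M. W 0 \<omega> = 0) \<and>
     (\<forall>\<omega>\<in>space M. continuous_on {0..} (\<lambda>t. W t \<omega>)) \<and>
     (\<forall>r t. 0 \<le> r \<and> r < t \<longrightarrow>
        distributed M lborel (\<lambda>\<omega>. W t \<omega> - W r \<omega>) (normal_density 0 (sqrt (t - r))) \<and>
        prob_space.indep_set M (sets (F r))
          {(\<lambda>\<omega>. W t \<omega> - W r \<omega>) -` B \<inter> space M | B. B \<in> sets borel})"

text \<open>
  For an adapted integrand H with continuous paths, the Ito integral over [t, r] is the limit in
  probability of the left-endpoint Riemann sums along any partitions with mesh tending to 0.
  Below it is only used for such integrands.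
\<close>

definition has_ito_integral ::
  "'a measure \<Rightarrow> (real \<Rightarrow> 'a \<Rightarrow> real) \<Rightarrow> (real \<Rightarrow> 'a \<Rightarrow> real) \<Rightarrow> real \<Rightarrow> real \<Rightarrow> ('a \<Rightarrow> real) \<Rightarrow> bool"
where
  "has_ito_integral M W H t r X \<longleftrightarrow>
     X \<in> borel_measurable M \<and>
     (\<forall>\<epsilon>>0. (\<lambda>n. measure M {\<omega>\<in>space M.
          \<epsilon> < \<bar>(\<Sum>i<n. H (t + real i * (r - t) / real n) \<omega> *
                    (W (t + real (Suc i) * (r - t) / real n) \<omega>
                     - W (t + real i * (r - t) / real n) \<omega>)) - X \<omega>\<bar>})
        \<longlonglongrightarrow> 0)"

definition inflow_process ::
  "'a measure \<Rightarrow> (real \<Rightarrow> 'a measure) \<Rightarrow> (real \<Rightarrow> 'a \<Rightarrow> real) \<Rightarrow> storage_model \<Rightarrow>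
   real \<Rightarrow> real \<Rightarrow> (real \<Rightarrow> 'a \<Rightarrow> real) \<Rightarrow> bool"
where
  "inflow_process M F W P t q Q \<longleftrightarrow>
     (\<forall>r\<in>{t..horizon P}. Q r \<in> borel_measurable (F r)) \<and>
     (\<forall>\<omega>\<in>space M. continuous_on {t..horizon P} (\<lambda>r. Q r \<omega>)) \<and>
     (\<forall>\<omega>\<in>space M. \<forall>r\<in>{t..horizon P}. 0 \<le> Q r \<omega>) \<and>
     (\<forall>r\<in>{t..horizon P}. \<exists>X. has_ito_integral M W (\<lambda>\<tau> \<omega>. sqrt (Q \<tau> \<omega>)) t r X \<and>
        (AE \<omega> in M. Q r \<omega> = q
            + (LINT \<tau>:{t..r}|lborel. reversion_rate P * (seasonal_target P \<tau> - Q \<tau> \<omega>))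
            + volatility P * X \<omega>))"

definition progressive ::
  "(real \<Rightarrow> 'a measure) \<Rightarrow> real \<Rightarrow> real \<Rightarrow> (real \<Rightarrow> 'a \<Rightarrow> real) \<Rightarrow> bool"
where
  "progressive F t T c \<longleftrightarrow>
     (\<forall>r\<in>{t..T}. (\<lambda>(\<tau>, \<omega>). c \<tau> \<omega>) \<in> borel_measurable (restrict_space borel {t..r} \<Otimes>\<^sub>M F r))"

definition storage_path ::
  "(real \<Rightarrow> 'a \<Rightarrow> real) \<Rightarrow> (real \<Rightarrow> 'a \<Rightarrow> real) \<Rightarrow> (real \<Rightarrow> 'a \<Rightarrow> real) \<Rightarrow> real \<Rightarrow> real \<Rightarrow> real \<Rightarrow> 'a \<Rightarrow> real"
where
  "storage_path Q u w t s r \<omega> = s + (LINT \<tau>:{t..r}|lborel. Q \<tau> \<omega> - u \<tau> \<omega> - w \<tau> \<omega>)"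

definition discounted_running_cost ::
  "storage_model \<Rightarrow> (real \<Rightarrow> 'a \<Rightarrow> real) \<Rightarrow> (real \<Rightarrow> 'a \<Rightarrow> real) \<Rightarrow> (real \<Rightarrow> 'a \<Rightarrow> real) \<Rightarrow>
   real \<Rightarrow> real \<Rightarrow> 'a \<Rightarrow> real \<Rightarrow> real"
where
  "discounted_running_cost P Q u w t s \<omega> \<tau> =
     exp (- discount_rate P * (\<tau> - t)) *
     running_cost P \<tau> (storage_path Q u w t s \<tau> \<omega>) (Q \<tau> \<omega>) (u \<tau> \<omega>) (w \<tau> \<omega>)"

definition path_cost ::
  "storage_model \<Rightarrow> (real \<Rightarrow> 'a \<Rightarrow> real) \<Rightarrow> (real \<Rightarrow> 'a \<Rightarrow> real) \<Rightarrow> (real \<Rightarrow> 'a \<Rightarrow> real) \<Rightarrow>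
   real \<Rightarrow> real \<Rightarrow> 'a \<Rightarrow> real"
where
  "path_cost P Q u w t s \<omega> =
     (LINT \<tau>:{t..horizon P}|lborel. discounted_running_cost P Q u w t s \<omega> \<tau>)
     + exp (- discount_rate P * (horizon P - t))
       * terminal_cost P (storage_path Q u w t s (horizon P) \<omega>)"

text \<open>
  Integrability of the cost is part of admissibility because the Bochner integral of a
  non-integrable function is 0 by convention, which would corrupt the infimum.
\<close>

definition admissible_control ::
  "'a measure \<Rightarrow> (real \<Rightarrow> 'a measure) \<Rightarrow> storage_model \<Rightarrow> real \<Rightarrow> real \<Rightarrow>
   (real \<Rightarrow> 'a \<Rightarrow> real) \<Rightarrow> (real \<Rightarrow> 'a \<Rightarrow> real) \<Rightarrow> (real \<Rightarrow> 'a \<Rightarrow> real) \<Rightarrow> bool"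
where
  "admissible_control M F P t s Q u w \<longleftrightarrow>
     progressive F t (horizon P) u \<and> progressive F t (horizon P) w \<and>
     (\<forall>\<tau>\<in>{t..horizon P}. \<forall>\<omega>\<in>space M. 0 \<le> u \<tau> \<omega> \<and> u \<tau> \<omega> \<le> release_max P \<and> 0 \<le> w \<tau> \<omega>) \<and>
     (AE \<omega> in M. set_integrable lborel {t..horizon P} (\<lambda>\<tau>. w \<tau> \<omega>)) \<and>
     (AE \<omega> in M. \<forall>\<tau>\<in>{t..horizon P}.
        0 \<le> storage_path Q u w t s \<tau> \<omega> \<and> storage_path Q u w t s \<tau> \<omega> \<le> storage_max P) \<and>
     (AE \<omega> in M. set_integrable lborel {t..horizon P} (discounted_running_cost P Q u w t s \<omega>)) \<and>
     integrable M (path_cost P Q u w t s)"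

definition value_function ::
  "'a measure \<Rightarrow> (real \<Rightarrow> 'a measure) \<Rightarrow> (real \<Rightarrow> 'a \<Rightarrow> real) \<Rightarrow> storage_model \<Rightarrow>
   real \<Rightarrow> real \<Rightarrow> real \<Rightarrow> ereal"
where
  "value_function M F W P t s q =
     Inf {ereal (integral\<^sup>L M (path_cost P Q u w t s)) | Q u w.
            inflow_process M F W P t q Q \<and> admissible_control M F P t s Q u w}"

subsection \<open>The Hamiltonian, the marginal avoided cost and the water value\<close>

text \<open>
  The expression minimized on the right-hand side of the HJB equation. The real arguments v, vs,
  vq, vqq stand for V and its partial derivatives in s, q, qq at the point (t, s, q).
\<close>

definition hjb_expression ::
  "storage_model \<Rightarrow> real \<Rightarrow> real \<Rightarrow> real \<Rightarrow> real \<Rightarrow> real \<Rightarrow> real \<Rightarrow> real \<Rightarrow> real \<Rightarrow> real \<Rightarrow> real"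
where
  "hjb_expression P t s q v vs vq vqq w u =
     running_cost P t s q u w + (q - u - w) * vs
     + reversion_rate P * (seasonal_target P t - q) * vq
     + 1/2 * (volatility P)\<^sup>2 * q * vqq - discount_rate P * v"

text \<open>
  Partial derivatives are taken within the domain of the variable, so they are one-sided at its
  end points.
\<close>

definition marginal_avoided_cost ::
  "storage_model \<Rightarrow> real \<Rightarrow> real \<Rightarrow> real \<Rightarrow> real \<Rightarrow> real \<Rightarrow> real"
where
  "marginal_avoided_cost P t s q w u =
     - vector_derivative (\<lambda>x. running_cost P t s q x w) (at u within {0..release_max P})"

definition storage_derivative ::
  "storage_model \<Rightarrow> (real \<Rightarrow> real \<Rightarrow> real \<Rightarrow> real) \<Rightarrow> real \<Rightarrow> real \<Rightarrow> real \<Rightarrow> real"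
where
  "storage_derivative P V t s q =
     vector_derivative (\<lambda>x. V t x q) (at s within {0..storage_max P})"

definition water_value ::
  "storage_model \<Rightarrow> (real \<Rightarrow> real \<Rightarrow> real \<Rightarrow> real) \<Rightarrow> real \<Rightarrow> real \<Rightarrow> real \<Rightarrow> real"
where
  "water_value P V t s q = - storage_derivative P V t s q"

definition hjb_release_minimizer ::
  "storage_model \<Rightarrow> (real \<Rightarrow> real \<Rightarrow> real \<Rightarrow> real) \<Rightarrow> real \<Rightarrow> real \<Rightarrow>
   real \<Rightarrow> real \<Rightarrow> real \<Rightarrow> real \<Rightarrow> real \<Rightarrow> bool"
where
  "hjb_release_minimizer P V vq vqq t s q w u \<longleftrightarrow>
     is_arg_min (hjb_expression P t s q (V t s q) (storage_derivative P V t s q) vq vqq w)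
       (\<lambda>u. 0 \<le> u \<and> u \<le> release_cap P t s q) u"

end

theory Submission
  imports Defs
begin

text \<open>
  In the release u, the HJB expression has derivative water value minus marginal avoided cost,
  which is nondecreasing in u. So a feasible u is a minimizer iff this derivative is nonnegative
  when u can be increased and nonpositive when u can be decreased.
\<close>

text \<open>The mean value theorem turns the chord slope between \<open>x\<close> and
  \<open>y\<close> into \<open>f' z\<close> for some \<open>z\<close> between them, and monotonicity
  of \<open>f'\<close> compares this with \<open>f' x\<close>. If \<open>y < x\<close>, both the
  comparison and the sign of \<open>y - x\<close> flip, so the inequality is the same. It is what
  makes the first-order conditions sufficient for a minimum.\<close>

lemma mono_derivative_above_tangent:
  fixes f f' :: "real \<Rightarrow> real"
  assumes deriv: "\<And>x. x \<in> {a..b} \<Longrightarrow> (f has_real_derivative f' x) (at x within {a..b})"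
    and mono: "mono_on {a..b} f'" and x: "x \<in> {a..b}" and y: "y \<in> {a..b}"
  shows "f' x * (y - x) \<le> f y - f x"
proof -
  have mvt: "\<exists>z\<in>{u..v}. f v - f u = f' z * (v - u)"
    if "u < v" "u \<in> {a..b}" "v \<in> {a..b}" for u v
  proof -
    have "\<exists>z\<in>{u<..<v}. f v - f u = (\<lambda>h. f' z * h) (v - u)"
    proof (rule mvt_simple[OF that(1)])
      fix z assume "u \<le> z" "z \<le> v"
      with that have "(f has_real_derivative f' z) (at z within {u..v})"
        by (intro DERIV_subset[OF deriv]) auto
      then show "(f has_derivative (\<lambda>h. f' z * h)) (at z within {u..v})"
        by (simp add: has_field_derivative_def)
    qed
    then show ?thesis by force
  qed
  consider "x < y" | "x = y" | "y < x" by linarith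
  then show ?thesis
  proof cases
    case 1
    with mvt x y obtain z where z: "z \<in> {x..y}" "f y - f x = f' z * (y - x)" by blast
    with x y have "f' x \<le> f' z" by (intro mono_onD[OF mono]) auto
    with z(2) 1 show ?thesis by (simp add: mult_right_mono)
  next
    case 3
    with mvt x y obtain z where z: "z \<in> {y..x}" "f x - f y = f' z * (x - y)" by blast
    with x y have "f' z \<le> f' x" by (intro mono_onD[OF mono]) auto
    with 3 have "f' z * (x - y) \<le> f' x * (x - y)" by (simp add: mult_right_mono)
    with z(2) show ?thesis by (simp add: algebra_simps)
  qed simp
qed

text \<open>The derivative is taken within \<open>{a..b}\<close> but the minimum over the possibly
  shorter \<open>{a..c}\<close>, as the release cap may lie below the turbine limit. Necessity comes
  from small feasible steps to the right and left, sufficiency from the tangent bound. If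
  \<open>c = a\<close>, both sign conditions are vacuous.\<close>

lemma is_arg_min_interval_iff:
  fixes f f' :: "real \<Rightarrow> real"
  assumes deriv: "\<And>x. x \<in> {a..b} \<Longrightarrow> (f has_real_derivative f' x) (at x within {a..b})"
    and mono: "mono_on {a..b} f'" and "c \<le> b"
  shows "is_arg_min f (\<lambda>x. a \<le> x \<and> x \<le> c) x \<longleftrightarrow>
    a \<le> x \<and> x \<le> c \<and> (x < c \<longrightarrow> 0 \<le> f' x) \<and> (a < x \<longrightarrow> f' x \<le> 0)"
    (is "?min \<longleftrightarrow> ?crit")
proof
  assume ?min
  then have x: "a \<le> x" "x \<le> c" and le: "\<And>y. a \<le> y \<Longrightarrow> y \<le> c \<Longrightarrow> f x \<le> f y"
    by (auto simp: is_arg_min_linorder)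
  have d: "(f has_real_derivative f' x) (at x within {a..b})"
    using x \<open>c \<le> b\<close> by (intro deriv) auto
  have "0 \<le> f' x" if "x < c"
  proof (rule ccontr)
    assume "\<not> 0 \<le> f' x"
    then obtain e where e: "0 < e" "\<And>h. 0 < h \<Longrightarrow> x + h \<in> {a..b} \<Longrightarrow> h < e \<Longrightarrow> f (x + h) < f x"
      using has_real_derivative_neg_dec_right[OF d] by auto
    \<comment> \<open>Half of \<open>e\<close> keeps the step strictly below \<open>e\<close>, where
      \<open>f\<close> decreases; the bound \<open>c - x\<close> keeps \<open>x + h\<close>
      feasible. The leftward step below is chosen likewise.\<close>
    define h where "h = min (e / 2) (c - x)"
    have "0 < h" "h < e" "x + h \<le> c" using e(1) that by (auto simp: h_def)
    with e(2)[of h] le[of "x + h"] x \<open>c \<le> b\<close> show False by auto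
  qed
  moreover have "f' x \<le> 0" if "a < x"
  proof (rule ccontr)
    assume "\<not> f' x \<le> 0"
    then obtain e where e: "0 < e" "\<And>h. 0 < h \<Longrightarrow> x - h \<in> {a..b} \<Longrightarrow> h < e \<Longrightarrow> f (x - h) < f x"
      using has_real_derivative_pos_inc_left[OF d] by auto
    define h where "h = min (e / 2) (x - a)"
    have "0 < h" "h < e" "a \<le> x - h" using e(1) that by (auto simp: h_def)
    with e(2)[of h] le[of "x - h"] x \<open>c \<le> b\<close> show False by auto
  qed
  ultimately show ?crit using x by blast
next
  assume crit: ?crit
  have "f x \<le> f y" if y: "a \<le> y" "y \<le> c" for y
  proof -
    have "f' x * (y - x) \<le> f y - f x"
      using y crit \<open>c \<le> b\<close> by (intro mono_derivative_above_tangent[OF deriv mono]) auto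
    \<comment> \<open>The two factors never have opposite signs: \<open>x < y\<close> forces
      \<open>x < c\<close>, so \<open>f' x\<close> is nonnegative, and \<open>y < x\<close> forces
      \<open>a < x\<close>, so it is nonpositive.\<close>
    moreover have "0 \<le> f' x * (y - x)"
      using crit y by (cases "x < y"; cases "y < x")
        (auto intro: mult_nonneg_nonneg mult_nonpos_nonpos)
    ultimately show ?thesis by linarith
  qed
  with crit show ?min by (auto simp: is_arg_min_linorder)
qed

text \<open>\<open>vector_derivative\<close> is a choice operator; differentiability ensures that it
  picks a genuine derivative, one-sided at the end points.\<close>

lemma has_real_derivative_marginal_avoided_cost:
  assumes "(\<lambda>u. running_cost P t s q u w) differentiable_on {0..release_max P}"
    and "u \<in> {0..release_max P}"
  shows "((\<lambda>u. running_cost P t s q u w) has_real_derivative - marginal_avoided_cost P t s q w u)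
    (at u within {0..release_max P})"
  using assms
  by (simp add: differentiable_on_def vector_derivative_works marginal_avoided_cost_def
      has_real_derivative_iff_has_vector_derivative)

lemma has_real_derivative_hjb_expression:
  assumes "(\<lambda>u. running_cost P t s q u w) differentiable_on {0..release_max P}"
    and "u \<in> {0..release_max P}"
  shows "(hjb_expression P t s q v vs vq vqq w has_real_derivative
      - vs - marginal_avoided_cost P t s q w u) (at u within {0..release_max P})"
  unfolding hjb_expression_def
  by (rule derivative_eq_intros has_real_derivative_marginal_avoided_cost[OF assms] refl | simp)+

theorem proposition3:
  fixes M :: "'a measure" and F :: "real \<Rightarrow> 'a measure" and W :: "real \<Rightarrow> 'a \<Rightarrow> real"
    and P :: storage_model and V :: "real \<Rightarrow> real \<Rightarrow> real \<Rightarrow> real"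
    and t s q w vq vqq :: real
  assumes "storage_model_wf P"
    and "filtered_space M F"
    and "standard_brownian_motion M F W"
    and V_value: "\<forall>t\<in>{0..horizon P}. \<forall>(s, q)\<in>state_space P.
                  value_function M F W P t s q = ereal (V t s q)"
    and "0 \<le> t" "t < horizon P" "(s, q) \<in> state_space P" "0 \<le> w"
    and V_diff: "(\<lambda>x. V t x q) differentiable (at s within {0..storage_max P})"
    and convex: "convex_on {0..release_max P} (\<lambda>u. running_cost P t s q u w)"
    and diff: "(\<lambda>u. running_cost P t s q u w) differentiable_on {0..release_max P}"
    and mono: "antimono_on {0..release_max P} (marginal_avoided_cost P t s q w)"
  shows
    "(marginal_avoided_cost P t s q w 0 \<le> water_value P V t s q \<longrightarrow>
        hjb_release_minimizer P V vq vqq t s q w 0 \<and>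
        (\<forall>u. hjb_release_minimizer P V vq vqq t s q w u \<longrightarrow>
             u = 0 \<or> marginal_avoided_cost P t s q w u = water_value P V t s q)) \<and>
     (marginal_avoided_cost P t s q w (release_cap P t s q) \<ge> water_value P V t s q \<longrightarrow>
        hjb_release_minimizer P V vq vqq t s q w (release_cap P t s q) \<and>
        (\<forall>u. hjb_release_minimizer P V vq vqq t s q w u \<longrightarrow>
             u = release_cap P t s q \<or>
             marginal_avoided_cost P t s q w u = water_value P V t s q)) \<and>
     (\<not> marginal_avoided_cost P t s q w 0 \<le> water_value P V t s q \<and>
      \<not> marginal_avoided_cost P t s q w (release_cap P t s q) \<ge> water_value P V t s q \<longrightarrow>
        (\<exists>u. hjb_release_minimizer P V vq vqq t s q w u) \<and>
        (\<forall>u. hjb_release_minimizer P V vq vqq t s q w u \<longleftrightarrow>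
             0 \<le> u \<and> u \<le> release_cap P t s q \<and>
             marginal_avoided_cost P t s q w u = water_value P V t s q))"
proof -
  let ?h = "hjb_expression P t s q (V t s q) (storage_derivative P V t s q) vq vqq w"
  let ?m = "marginal_avoided_cost P t s q w"
  let ?lam = "water_value P V t s q"
  let ?c = "release_cap P t s q"
  have c: "0 \<le> ?c" "?c \<le> release_max P"
    using assms by (auto simp: storage_model_wf_def)
  have deriv: "(?h has_real_derivative ?lam - ?m u) (at u within {0..release_max P})"
    if "u \<in> {0..release_max P}" for u
    using has_real_derivative_hjb_expression[OF diff that] by (simp add: water_value_def)
  have anti: "?m v \<le> ?m u" if "0 \<le> u" "u \<le> v" "v \<le> ?c" for u v
    using monotone_onD[OF mono, of u v] that c by auto
  \<comment> \<open>The criterion is applied with \<open>a = 0\<close>,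
    \<open>b = release_max P\<close> and \<open>c = ?c\<close>; \<open>?lam - ?m u\<close> is
    nondecreasing because \<open>?m\<close> is nonincreasing.\<close>
  have min_iff: "hjb_release_minimizer P V vq vqq t s q w u \<longleftrightarrow>
      0 \<le> u \<and> u \<le> ?c \<and> (u < ?c \<longrightarrow> ?m u \<le> ?lam) \<and> (0 < u \<longrightarrow> ?lam \<le> ?m u)" for u
    unfolding hjb_release_minimizer_def
    using is_arg_min_interval_iff[where f = ?h and f' = "\<lambda>u. ?lam - ?m u", OF deriv _ c(2)]
      monotone_onD[OF mono]
    by (auto simp: monotone_on_def)
  \<comment> \<open>Existence comes from compactness of \<open>{0..?c}\<close> and continuity of
    \<open>?h\<close>. This avoids solving \<open>?m u = ?lam\<close> by intermediate values, which
    would call for continuity of \<open>?m\<close>.\<close>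
  have "continuous_on {0..?c} ?h"
    using c(2) by (intro continuous_on_subset[OF DERIV_continuous_on[OF deriv]]) auto
  then have ex: "\<exists>u. hjb_release_minimizer P V vq vqq t s q w u"
    using continuous_attains_inf[of "{0..?c}" ?h] c(1)
    by (auto simp: hjb_release_minimizer_def is_arg_min_linorder)
  show ?thesis
  proof (intro conjI impI allI)
    assume low: "?m 0 \<le> ?lam"
    then show "hjb_release_minimizer P V vq vqq t s q w 0" using c by (simp add: min_iff)
    \<comment> \<open>A minimizer \<open>u > 0\<close> satisfies
      \<open>?lam <= ?m u <= ?m 0 <= ?lam\<close>. Further minimizers thus occur only where
      \<open>?m\<close> stays at the level \<open>?lam\<close>.\<close>
    show "u = 0 \<or> ?m u = ?lam" if "hjb_release_minimizer P V vq vqq t s q w u" for u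
      using that low anti[of 0 u] by (auto simp: min_iff)
  next
    assume high: "?lam \<le> ?m ?c"
    then show "hjb_release_minimizer P V vq vqq t s q w ?c" using c by (simp add: min_iff)
    show "u = ?c \<or> ?m u = ?lam" if "hjb_release_minimizer P V vq vqq t s q w u" for u
      using that high anti[of u ?c] by (auto simp: min_iff)
  next
    assume inner: "\<not> ?m 0 \<le> ?lam \<and> \<not> ?lam \<le> ?m ?c"
    show "\<exists>u. hjb_release_minimizer P V vq vqq t s q w u" by (rule ex)
    \<comment> \<open>The strict inequalities rule out \<open>?c = 0\<close> and exclude both end
      points on either side of the equivalence. At the remaining \<open>u\<close> both sign
      conditions are active and together say \<open>?m u = ?lam\<close>.\<close>
    show "hjb_release_minimizer P V vq vqq t s q w u \<longleftrightarrow> 0 \<le> u \<and> u \<le> ?c \<and> ?m u = ?lam" for u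
      using inner c by (cases "u = 0"; cases "u = ?c") (auto simp: min_iff)
  qed
qed

end
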